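(* The Cesàro operator $C$, defined by $(Cf)(x)=\frac1x\int_0^x\frac{f(t)}{1-t}\,dt$ for $0<x<1$, is a bounded linear operator on $L^2(0,1)$.
   Context: $L^2(0,1)$ is the Hilbert space of complex-valued square-integrable functions on $(0,1)$ with respect to Lebesgue measure. *)

theory Defs
  imports "HOL-Analysis.Analysis"
begin

abbreviation unit_interval_measure :: "real measure" where
  "unit_interval_measure \<equiv> lebesgue_on {0<..<1}"

definition square_integrable :: "(real \<Rightarrow> complex) \<Rightarrow> bool" where
  "square_integrable f \<longleftrightarrow>
     f \<in> borel_measurable unit_interval_measure \<and>
     integrable unit_interval_measure (\<lambda>x. (cmod (f x))\<^sup>2)"

lemma square_integrable_zero: "square_integrable (\<lambda>_. 0)"
  by (simp add: square_integrable_def)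

lemma square_integrable_scale:
  assumes "square_integrable f"
  shows "square_integrable (\<lambda>x. c * f x)"
  using assms by (auto simp: square_integrable_def norm_mult power_mult_distrib)

lemma square_integrable_add:
  assumes "square_integrable f" "square_integrable g"
  shows "square_integrable (\<lambda>x. f x + g x)"
proof -
  have m [measurable]: "f \<in> borel_measurable unit_interval_measure"
    "g \<in> borel_measurable unit_interval_measure"
    using assms by (auto simp: square_integrable_def)
  have i: "integrable unit_interval_measure (\<lambda>x. 2 * (cmod (f x))\<^sup>2 + 2 * (cmod (g x))\<^sup>2)"
    using assms by (auto simp: square_integrable_def)
  have b: "(cmod (f x + g x))\<^sup>2 \<le> 2 * (cmod (f x))\<^sup>2 + 2 * (cmod (g x))\<^sup>2" for x
  proof -
    have "(cmod (f x + g x))\<^sup>2 \<le> (cmod (f x) + cmod (g x))\<^sup>2"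
      by (intro power_mono norm_triangle_ineq) auto
    also have "\<dots> \<le> 2 * (cmod (f x))\<^sup>2 + 2 * (cmod (g x))\<^sup>2"
      using sum_squares_bound[of "cmod (f x)" "cmod (g x)"] by (simp add: power2_sum)
    finally show ?thesis .
  qed
  have "integrable unit_interval_measure (\<lambda>x. (cmod (f x + g x))\<^sup>2)"
  proof (rule Bochner_Integration.integrable_bound[OF i])
    show "AE x in unit_interval_measure. norm ((cmod (f x + g x))\<^sup>2)
            \<le> norm (2 * (cmod (f x))\<^sup>2 + 2 * (cmod (g x))\<^sup>2)"
      using b by simp
  qed measurable
  then show ?thesis by (simp add: square_integrable_def)
qed

lemma integrable_mult_cnj:
  assumes "square_integrable f" "square_integrable g"
  shows "integrable unit_interval_measure (\<lambda>x. f x * cnj (g x))"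
proof -
  have m [measurable]: "f \<in> borel_measurable unit_interval_measure"
    "g \<in> borel_measurable unit_interval_measure"
    using assms by (auto simp: square_integrable_def)
  have m2: "(\<lambda>x. f x * cnj (g x)) \<in> borel_measurable unit_interval_measure"
    by (intro borel_measurable_times m(1) borel_measurable_continuous_on[OF _ m(2)] continuous_intros)
  have i: "integrable unit_interval_measure (\<lambda>x. (cmod (f x))\<^sup>2 + (cmod (g x))\<^sup>2)"
    using assms by (auto simp: square_integrable_def)
  have b: "norm (f x * cnj (g x)) \<le> norm ((cmod (f x))\<^sup>2 + (cmod (g x))\<^sup>2)" for x
  proof -
    have "0 \<le> cmod (f x) * cmod (g x)" by simp
    moreover have "2 * (cmod (f x) * cmod (g x)) \<le> (cmod (f x))\<^sup>2 + (cmod (g x))\<^sup>2"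
      using sum_squares_bound[of "cmod (f x)" "cmod (g x)"] by (simp add: mult.assoc)
    ultimately have "cmod (f x) * cmod (g x) \<le> (cmod (f x))\<^sup>2 + (cmod (g x))\<^sup>2"
      by linarith
    then show ?thesis by (simp add: norm_mult)
  qed
  show ?thesis
    by (rule Bochner_Integration.integrable_bound[OF i m2]) (simp only: b AE_I2)
qed

quotient_type L2 = "real \<Rightarrow> complex" / partial:
  "\<lambda>f g. square_integrable f \<and> square_integrable g \<and> (AE x in unit_interval_measure. f x = g x)"
  morphisms rep_L2 L2_class
proof (rule part_equivpI)
  show "\<exists>f. square_integrable f \<and> square_integrable f \<and> (AE x in unit_interval_measure. f x = f x)"
    using square_integrable_zero by blast
qed (auto intro!: sympI transpI)

lemma L2_class_eq_iff:
  assumes "square_integrable f" "square_integrable g"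
  shows "L2_class f = L2_class g \<longleftrightarrow> (AE x in unit_interval_measure. f x = g x)"
  using Quotient3_rel[OF Quotient3_L2, of f g] assms by auto

instantiation L2 :: real_vector
begin

lift_definition zero_L2 :: L2 is "\<lambda>_. 0"
  by (simp add: square_integrable_zero)

lift_definition plus_L2 :: "L2 \<Rightarrow> L2 \<Rightarrow> L2" is "\<lambda>f g x. f x + g x"
  by (auto intro: square_integrable_add)

lift_definition scaleC_L2 :: "complex \<Rightarrow> L2 \<Rightarrow> L2" is "\<lambda>c f x. c * f x"
  by (auto intro: square_integrable_scale)

definition uminus_L2 :: "L2 \<Rightarrow> L2" where "uminus_L2 u = scaleC_L2 (-1) u"

definition minus_L2 :: "L2 \<Rightarrow> L2 \<Rightarrow> L2" where "minus_L2 u v = u + (- v)"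

definition scaleR_L2 :: "real \<Rightarrow> L2 \<Rightarrow> L2" where "scaleR_L2 r u = scaleC_L2 (complex_of_real r) u"

instance
proof
  fix u v w :: L2 and a b :: real
  show "u + v + w = u + (v + w)"
    by transfer (auto simp: add.assoc intro!: square_integrable_add)
  show "u + v = v + u"
    by transfer (auto simp: add.commute intro!: square_integrable_add)
  show "0 + u = u"
    by transfer auto
  show "- u + u = 0"
    unfolding uminus_L2_def
    by transfer (auto simp: square_integrable_zero)
  show "u - v = u + - v"
    by (simp add: minus_L2_def)
  show "a *\<^sub>R (u + v) = a *\<^sub>R u + a *\<^sub>R v"
    unfolding scaleR_L2_def
    by transfer (auto simp: distrib_left intro!: square_integrable_add square_integrable_scale)
  show "(a + b) *\<^sub>R u = a *\<^sub>R u + b *\<^sub>R u"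
    unfolding scaleR_L2_def
    by transfer (auto simp: distrib_right intro!: square_integrable_add square_integrable_scale)
  show "a *\<^sub>R b *\<^sub>R u = (a * b) *\<^sub>R u"
    unfolding scaleR_L2_def
    by transfer (auto simp: mult.assoc intro!: square_integrable_scale)
  show "1 *\<^sub>R u = u"
    unfolding scaleR_L2_def by transfer auto
qed

end

lift_definition cinner_L2 :: "L2 \<Rightarrow> L2 \<Rightarrow> complex" is
  "\<lambda>f g. integral\<^sup>L unit_interval_measure (\<lambda>x. f x * cnj (g x))"
proof -
  fix f f' g g' :: "real \<Rightarrow> complex"
  assume f: "square_integrable f \<and> square_integrable f' \<and> (AE x in unit_interval_measure. f x = f' x)"
    and g: "square_integrable g \<and> square_integrable g' \<and> (AE x in unit_interval_measure. g x = g' x)"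
  show "integral\<^sup>L unit_interval_measure (\<lambda>x. f x * cnj (g x)) =
        integral\<^sup>L unit_interval_measure (\<lambda>x. f' x * cnj (g' x))"
  proof (rule integral_cong_AE)
    show "(\<lambda>x. f x * cnj (g x)) \<in> borel_measurable unit_interval_measure"
      "(\<lambda>x. f' x * cnj (g' x)) \<in> borel_measurable unit_interval_measure"
      using f g by (simp_all add: borel_measurable_integrable integrable_mult_cnj)
    have "AE x in unit_interval_measure. f x = f' x" "AE x in unit_interval_measure. g x = g' x"
      using f g by simp_all
    then show "AE x in unit_interval_measure. f x * cnj (g x) = f' x * cnj (g' x)"
      by eventually_elim simp
  qed
qed

lemma cinner_L2_commute: "cinner_L2 v u = cnj (cinner_L2 u v)"
proof (transfer, elim conjE)
  fix f g :: "real \<Rightarrow> complex"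
  have "(\<lambda>x. g x * cnj (f x)) = (\<lambda>x. cnj (f x * cnj (g x)))"
    by (simp add: mult.commute)
  then show "integral\<^sup>L unit_interval_measure (\<lambda>x. g x * cnj (f x)) =
        cnj (integral\<^sup>L unit_interval_measure (\<lambda>x. f x * cnj (g x)))"
    by (simp only: Bochner_Integration.integral_cnj)
qed

lemma cinner_L2_add_left: "cinner_L2 (u + v) w = cinner_L2 u w + cinner_L2 v w"
  by transfer (simp add: distrib_right integrable_mult_cnj)

lemma cinner_L2_scaleC_left: "cinner_L2 (scaleC_L2 c u) v = c * cinner_L2 u v"
  by transfer (simp add: mult.assoc)

lemma cinner_L2_self:
  assumes "square_integrable f"
  shows "cinner_L2 (L2_class f) (L2_class f) =
         complex_of_real (integral\<^sup>L unit_interval_measure (\<lambda>x. (cmod (f x))\<^sup>2))"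
proof -
  have "cinner_L2 (L2_class f) (L2_class f) =
        integral\<^sup>L unit_interval_measure (\<lambda>x. f x * cnj (f x))"
    using assms by (simp add: cinner_L2.abs_eq)
  also have "\<dots> = integral\<^sup>L unit_interval_measure (\<lambda>x. complex_of_real ((cmod (f x))\<^sup>2))"
    by (simp only: complex_norm_square)
  finally show ?thesis by (simp only: integral_complex_of_real)
qed

lemma L2_class_cases:
  obtains f where "square_integrable f" "u = L2_class f"
proof -
  have "\<exists>f. square_integrable f \<and> u = L2_class f"
    by (induction u rule: L2.abs_induct) blast
  then show ?thesis using that by blast
qed

text \<open>
  The distribution has no class of complex inner product spaces, so the type is made an instance
  of the real class with the real part of the complex inner product; both induce the same norm.
\<close>

instantiation L2 :: real_inner
begin

definition inner_L2 :: "L2 \<Rightarrow> L2 \<Rightarrow> real" where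
  "inner_L2 u v = Re (cinner_L2 u v)"

definition norm_L2 :: "L2 \<Rightarrow> real" where
  "norm_L2 u = sqrt (Re (cinner_L2 u u))"

definition sgn_L2 :: "L2 \<Rightarrow> L2" where
  "sgn_L2 u = u /\<^sub>R norm u"

definition dist_L2 :: "L2 \<Rightarrow> L2 \<Rightarrow> real" where
  "dist_L2 u v = norm (u - v)"

definition uniformity_L2 :: "(L2 \<times> L2) filter" where
  "uniformity_L2 = (INF e\<in>{0<..}. principal {(u, v). dist u v < e})"

definition open_L2 :: "L2 set \<Rightarrow> bool" where
  "open_L2 U \<longleftrightarrow> (\<forall>u\<in>U. eventually (\<lambda>(u', v). u' = u \<longrightarrow> v \<in> U) uniformity)"

instance
proof
  fix u v w :: L2 and r :: real and U :: "L2 set"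
  show "dist u v = norm (u - v)" by (simp add: dist_L2_def)
  show "sgn u = u /\<^sub>R norm u" by (simp add: sgn_L2_def)
  show "uniformity = (INF e\<in>{0<..}. principal {(u :: L2, v). dist u v < e})"
    by (simp add: uniformity_L2_def)
  show "open U \<longleftrightarrow> (\<forall>u\<in>U. \<forall>\<^sub>F (u', v) in uniformity. u' = u \<longrightarrow> v \<in> U)"
    by (simp add: open_L2_def)
  show "inner u v = inner v u"
    unfolding inner_L2_def by (subst cinner_L2_commute) simp
  show "inner (u + v) w = inner u w + inner v w"
    by (simp add: inner_L2_def cinner_L2_add_left)
  show "inner (r *\<^sub>R u) v = r * inner u v"
    by (simp add: inner_L2_def scaleR_L2_def cinner_L2_scaleC_left)
  obtain f where f: "square_integrable f" "u = L2_class f" by (rule L2_class_cases)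
  have eq: "inner u u = integral\<^sup>L unit_interval_measure (\<lambda>x. (cmod (f x))\<^sup>2)"
    using f by (simp add: inner_L2_def cinner_L2_self)
  show "0 \<le> inner u u" unfolding eq by simp
  have "inner u u = 0 \<longleftrightarrow> (AE x in unit_interval_measure. (cmod (f x))\<^sup>2 = 0)"
    unfolding eq using f(1)
    by (intro integral_nonneg_eq_0_iff_AE) (auto simp: square_integrable_def)
  also have "\<dots> \<longleftrightarrow> u = 0"
    unfolding f(2) zero_L2_def using f(1) square_integrable_zero
    by (simp add: L2_class_eq_iff)
  finally show "inner u u = 0 \<longleftrightarrow> u = 0" .
  show "norm u = sqrt (inner u u)" by (simp add: norm_L2_def inner_L2_def)
qed

end

lemma norm_L2_class:
  assumes "square_integrable f"
  shows "norm (L2_class f) = sqrt (integral\<^sup>L unit_interval_measure (\<lambda>x. (cmod (f x))\<^sup>2))"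
  using assms by (simp add: norm_L2_def cinner_L2_self)

text \<open>
  Only the values for \<open>0 < x < 1\<close> matter. Bochner integrals of non-integrable functions are
  \<open>0\<close>, so integrability of the integrand has to be asserted separately.
\<close>

definition cesaro :: "(real \<Rightarrow> complex) \<Rightarrow> real \<Rightarrow> complex" where
  "cesaro f x = complex_of_real (1 / x) *
     set_lebesgue_integral lebesgue {0<..<x} (\<lambda>t. f t / complex_of_real (1 - t))"

end

theory Submission
  imports Defs
begin

text \<open>
  On \<open>(0,1)\<close> the operator has the nonnegative kernel \<open>k(x,t) = 1 / (x (1 - t))\<close> for \<open>t < x\<close>, and
  \<open>k(x,t) = 0\<close> otherwise. It behaves like the Hardy averaging operator near \<open>0\<close> and like the
  adjoint of that operator near \<open>1\<close>. Both are bounded because of Schur's test: a nonnegative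
  kernel is bounded on \<open>L\<^sup>2\<close> as soon as some positive weight is reproduced up to constants when the
  kernel is integrated against it in either variable (\<open>schur_test\<close>).

  A single weight serves both endpoints, \<open>w(t) = (t (1 - t))\<^bsup>-1/2\<^esup>\<close>. The derivatives of
  \<open>sqrt (t / (1 - t))\<close> and \<open>sqrt ((1 - x) / x)\<close> are \<open>w(t) / (2 (1 - t))\<close> and \<open>- w(x) / (2 x)\<close>,
  so that the two integrals can be evaluated exactly:
  \<open>\<integral> k(x,t) w(t) dt = 2 w(x)\<close> and \<open>\<integral> k(x,t) w(x) dx = 2 w(t)\<close>
  (\<open>cesaro_kernel_row\<close>, \<open>cesaro_kernel_column\<close>). Hence the operator norm is at most \<open>2\<close>.

  The value of the operator at each single point \<open>x < 1\<close> depends only on the class of the function: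
  the factor \<open>1 / (1 - t)\<close> is bounded for \<open>t < x\<close>, so the integrand is integrable, and changing it on
  a null set does not change the integral. The operator therefore descends to classes, where linearity
  is that of the integral.
\<close>

section \<open>Schur's test\<close>

text \<open>
  Split \<open>k g = sqrt (k q) * (sqrt (k / q) * g)\<close> and apply Cauchy--Schwarz in \<open>y\<close>. The first factor is
  controlled by the row bound; after exchanging the integrals, the second one is controlled by the
  column bound, and the weights cancel.
\<close>

lemma schur_test:
  fixes k :: "'a \<Rightarrow> 'b \<Rightarrow> real" and p :: "'a \<Rightarrow> real" and q g :: "'b \<Rightarrow> real" and A B :: ennreal
  assumes M: "sigma_finite_measure M" and N: "sigma_finite_measure N"
    and k [measurable]: "(\<lambda>(x, y). k x y) \<in> borel_measurable (M \<Otimes>\<^sub>M N)"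
    and p [measurable]: "p \<in> borel_measurable M"
    and q [measurable]: "q \<in> borel_measurable N"
    and g [measurable]: "g \<in> borel_measurable N"
    and k_nonneg: "\<And>x y. x \<in> space M \<Longrightarrow> y \<in> space N \<Longrightarrow> 0 \<le> k x y"
    and p_nonneg: "\<And>x. x \<in> space M \<Longrightarrow> 0 \<le> p x"
    and q_pos: "\<And>y. y \<in> space N \<Longrightarrow> 0 < q y"
    and g_nonneg: "\<And>y. y \<in> space N \<Longrightarrow> 0 \<le> g y"
    and row: "\<And>x. x \<in> space M \<Longrightarrow> (\<integral>\<^sup>+y. k x y * q y \<partial>N) \<le> A * p x"
    and col: "\<And>y. y \<in> space N \<Longrightarrow> (\<integral>\<^sup>+x. k x y * p x \<partial>M) \<le> B * q y"
  shows "(\<integral>\<^sup>+x. (\<integral>\<^sup>+y. k x y * g y \<partial>N)\<^sup>2 \<partial>M) \<le> A * B * (\<integral>\<^sup>+y. (g y)\<^sup>2 \<partial>N)"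
proof -
  interpret M: sigma_finite_measure M by fact
  interpret N: sigma_finite_measure N by fact
  interpret MN: pair_sigma_finite M N by unfold_locales
  have pointwise: "(\<integral>\<^sup>+y. k x y * g y \<partial>N)\<^sup>2 \<le> A * (\<integral>\<^sup>+y. k x y * p x * ((g y)\<^sup>2 / q y) \<partial>N)"
    if x: "x \<in> space M" for x
  proof -
    have kx [measurable]: "k x \<in> borel_measurable N"
      using measurable_compose[OF measurable_Pair1'[OF x] k] by simp
    have "(\<integral>\<^sup>+y. k x y * g y \<partial>N) =
        (\<integral>\<^sup>+y. ennreal (sqrt (k x y * q y)) * ennreal (sqrt (k x y * (g y)\<^sup>2 / q y)) \<partial>N)"
    proof (rule nn_integral_cong)
      fix y assume y: "y \<in> space N"
      have "sqrt (k x y * q y) * sqrt (k x y * (g y)\<^sup>2 / q y) = sqrt ((k x y * g y)\<^sup>2)"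
        using q_pos[OF y] by (simp flip: real_sqrt_mult add: power2_eq_square field_simps)
      also have "\<dots> = k x y * g y"
        using k_nonneg[OF x y] g_nonneg[OF y] by simp
      finally show "ennreal (k x y * g y) =
          ennreal (sqrt (k x y * q y)) * ennreal (sqrt (k x y * (g y)\<^sup>2 / q y))"
        using k_nonneg[OF x y] q_pos[OF y] by (simp flip: ennreal_mult)
    qed
    also have "\<dots>\<^sup>2 \<le> (\<integral>\<^sup>+y. (ennreal (sqrt (k x y * q y)))\<^sup>2 \<partial>N) *
        (\<integral>\<^sup>+y. (ennreal (sqrt (k x y * (g y)\<^sup>2 / q y)))\<^sup>2 \<partial>N)"
      by (rule Cauchy_Schwarz_nn_integral) measurable
    also have "(\<integral>\<^sup>+y. (ennreal (sqrt (k x y * q y)))\<^sup>2 \<partial>N) = (\<integral>\<^sup>+y. k x y * q y \<partial>N)"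
      using k_nonneg[OF x] q_pos
      by (intro nn_integral_cong) (simp add: ennreal_power less_imp_le)
    also have "(\<integral>\<^sup>+y. (ennreal (sqrt (k x y * (g y)\<^sup>2 / q y)))\<^sup>2 \<partial>N) =
        (\<integral>\<^sup>+y. k x y * (g y)\<^sup>2 / q y \<partial>N)"
      using k_nonneg[OF x] q_pos
      by (intro nn_integral_cong) (simp add: ennreal_power less_imp_le)
    also have "(\<integral>\<^sup>+y. k x y * q y \<partial>N) * (\<integral>\<^sup>+y. k x y * (g y)\<^sup>2 / q y \<partial>N) \<le>
        A * p x * (\<integral>\<^sup>+y. k x y * (g y)\<^sup>2 / q y \<partial>N)"
      by (intro mult_right_mono row x) simp
    also have "\<dots> = A * (\<integral>\<^sup>+y. ennreal (p x) * ennreal (k x y * (g y)\<^sup>2 / q y) \<partial>N)"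
      by (subst nn_integral_cmult) (auto simp: mult.assoc)
    also have "(\<integral>\<^sup>+y. ennreal (p x) * ennreal (k x y * (g y)\<^sup>2 / q y) \<partial>N) =
        (\<integral>\<^sup>+y. k x y * p x * ((g y)\<^sup>2 / q y) \<partial>N)"
      using k_nonneg[OF x] q_pos p_nonneg[OF x]
      by (intro nn_integral_cong) (simp flip: ennreal_mult add: less_imp_le mult_ac)
    finally show ?thesis .
  qed
  have "(\<integral>\<^sup>+x. (\<integral>\<^sup>+y. k x y * g y \<partial>N)\<^sup>2 \<partial>M) \<le>
      (\<integral>\<^sup>+x. A * (\<integral>\<^sup>+y. k x y * p x * ((g y)\<^sup>2 / q y) \<partial>N) \<partial>M)"
    by (intro nn_integral_mono pointwise)
  also have "\<dots> = A * (\<integral>\<^sup>+x. (\<integral>\<^sup>+y. k x y * p x * ((g y)\<^sup>2 / q y) \<partial>N) \<partial>M)"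
    by (rule nn_integral_cmult) measurable
  also have "(\<integral>\<^sup>+x. (\<integral>\<^sup>+y. k x y * p x * ((g y)\<^sup>2 / q y) \<partial>N) \<partial>M) =
      (\<integral>\<^sup>+y. (\<integral>\<^sup>+x. k x y * p x * ((g y)\<^sup>2 / q y) \<partial>M) \<partial>N)"
    by (rule MN.Fubini'[symmetric]) measurable
  also have "\<dots> \<le> (\<integral>\<^sup>+y. B * (g y)\<^sup>2 \<partial>N)"
  proof (rule nn_integral_mono)
    fix y assume y: "y \<in> space N"
    \<comment> \<open>The weight \<open>q y\<close> from the column bound cancels the denominator left by Cauchy--Schwarz.\<close>
    have ky [measurable]: "(\<lambda>x. k x y) \<in> borel_measurable M"
      using measurable_compose[OF measurable_Pair2'[OF y] k] by simp
    have "(\<integral>\<^sup>+x. k x y * p x * ((g y)\<^sup>2 / q y) \<partial>M) =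
        (\<integral>\<^sup>+x. ennreal (k x y * p x) * ennreal ((g y)\<^sup>2 / q y) \<partial>M)"
      using k_nonneg[OF _ y] p_nonneg q_pos[OF y]
      by (intro nn_integral_cong ennreal_mult) (auto simp: less_imp_le)
    also have "\<dots> = (\<integral>\<^sup>+x. k x y * p x \<partial>M) * ennreal ((g y)\<^sup>2 / q y)"
      by (rule nn_integral_multc) measurable
    also have "\<dots> \<le> B * q y * ennreal ((g y)\<^sup>2 / q y)"
      by (intro mult_right_mono col y) simp
    also have "\<dots> = B * (g y)\<^sup>2"
      using q_pos[OF y] by (simp add: mult.assoc flip: ennreal_mult)
    finally show "(\<integral>\<^sup>+x. k x y * p x * ((g y)\<^sup>2 / q y) \<partial>M) \<le> B * (g y)\<^sup>2" .
  qed
  also have "\<dots> = B * (\<integral>\<^sup>+y. (g y)\<^sup>2 \<partial>N)"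
    by (rule nn_integral_cmult) measurable
  finally show ?thesis
    by (simp add: mult.assoc mult_left_mono)
qed

section \<open>The kernel and its weight\<close>

definition cesaro_kernel :: "real \<Rightarrow> real \<Rightarrow> real" where
  "cesaro_kernel x t = (if t < x then 1 / (x * (1 - t)) else 0)"

text \<open>
  The geometric mean of \<open>1 / t\<close> and \<open>1 / (1 - t)\<close>: its singularities of order one half at the two
  endpoints are those that the Hardy operator and its adjoint reproduce.
\<close>

definition cesaro_weight :: "real \<Rightarrow> real" where
  "cesaro_weight t = 1 / sqrt (t * (1 - t))"

lemma nn_integral_unit_interval:
  "(\<integral>\<^sup>+t. f t \<partial>unit_interval_measure) = (\<integral>\<^sup>+t. f t * indicator {0<..<1} t \<partial>lborel)"
  by (subst nn_integral_restrict_space) (auto simp: nn_integral_completion)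

text \<open>
  The derivative may blow up at the ends of the interval, which the weighted kernel does at \<open>0\<close> and
  \<open>1\<close>; continuity of the antiderivative suffices there. The integrand \<open>h\<close> is kept apart from \<open>f\<close>
  because the kernel carries its own cutoff at the diagonal.
\<close>

lemma nn_integral_unit_interval_FTC:
  fixes F f h :: "real \<Rightarrow> real"
  assumes ab: "0 \<le> a" "a \<le> b" "b \<le> 1"
    and F: "continuous_on {a..b} F"
    and f: "\<And>t. t \<in> {a<..<b} \<Longrightarrow> (F has_real_derivative f t) (at t)"
    and f_nonneg: "\<And>t. t \<in> {a<..<b} \<Longrightarrow> 0 \<le> f t"
    and h: "\<And>t. t \<in> {0<..<1} \<Longrightarrow> h t = indicator {a<..<b} t * f t"
  shows "(\<integral>\<^sup>+t. h t \<partial>unit_interval_measure) = F b - F a"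
proof -
  have "(f has_integral (F b - F a)) {a..b}"
    using f by (intro fundamental_theorem_of_calculus_interior ab F)
      (auto simp: has_real_derivative_iff_has_vector_derivative)
  then have "(f has_integral (F b - F a)) {a<..<b}"
    by (simp add: has_integral_Icc_iff_Ioo)
  then have "(\<integral>\<^sup>+t. ennreal (f t) * indicator {a<..<b} t \<partial>lborel) = F b - F a"
    using f_nonneg by (intro nn_integral_has_integral_lebesgue') auto
  moreover have "(\<integral>\<^sup>+t. h t \<partial>unit_interval_measure) =
      (\<integral>\<^sup>+t. ennreal (f t) * indicator {a<..<b} t \<partial>lborel)"
    unfolding nn_integral_unit_interval using ab
    by (intro nn_integral_cong) (auto simp: h indicator_def)
  ultimately show ?thesis by simp
qed

text \<open>
  The antiderivative in \<open>t\<close> is \<open>2 / x * sqrt (t / (1 - t))\<close>, which vanishes at \<open>0\<close>.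
\<close>

lemma cesaro_kernel_row:
  assumes x: "0 < x" "x < 1"
  shows "(\<integral>\<^sup>+t. cesaro_kernel x t * cesaro_weight t \<partial>unit_interval_measure) = 2 * ennreal (cesaro_weight x)"
proof -
  have "(\<integral>\<^sup>+t. cesaro_kernel x t * cesaro_weight t \<partial>unit_interval_measure) =
      2 / x * sqrt (x / (1 - x)) - 2 / x * sqrt (0 / (1 - 0))"
  proof (rule nn_integral_unit_interval_FTC[where F = "\<lambda>t. 2 / x * sqrt (t / (1 - t))"
        and f = "\<lambda>t. 1 / (x * (1 - t)) * cesaro_weight t" and a = 0 and b = x])
    show "continuous_on {0..x} (\<lambda>t. 2 / x * sqrt (t / (1 - t)))"
      using x by (intro continuous_intros) auto
    show "((\<lambda>t. 2 / x * sqrt (t / (1 - t))) has_real_derivative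
        1 / (x * (1 - t)) * cesaro_weight t) (at t)" if "t \<in> {0<..<x}" for t
    proof -
      have t: "0 < t" "t < 1" using that x by auto
      have "((\<lambda>t. 2 / x * sqrt (t / (1 - t))) has_real_derivative
          2 / x * (inverse (sqrt (t / (1 - t))) / 2 * ((1 - t + t) / (1 - t)\<^sup>2))) (at t)"
        using t x by (auto intro!: derivative_eq_intros simp: power2_eq_square divide_less_0_iff)
      moreover have "inverse (sqrt (t / (1 - t))) = (1 - t) * cesaro_weight t"
      proof -
        have "sqrt (1 - t) * sqrt (1 - t) = 1 - t" using t by simp
        then show ?thesis
          unfolding cesaro_weight_def real_sqrt_divide real_sqrt_mult
          using t by (simp add: field_simps)
      qed
      then have "2 / x * (inverse (sqrt (t / (1 - t))) / 2 * ((1 - t + t) / (1 - t)\<^sup>2)) =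
          1 / (x * (1 - t)) * cesaro_weight t"
        using t x by (simp only:) (simp add: divide_simps power2_eq_square)
      ultimately show ?thesis by (rule DERIV_cong)
    qed
  qed (use x in \<open>auto simp: cesaro_kernel_def cesaro_weight_def\<close>)
  also have "2 / x * sqrt (x / (1 - x)) - 2 / x * sqrt (0 / (1 - 0)) = 2 * cesaro_weight x"
  proof -
    have "sqrt x * sqrt x = x" using x by simp
    then show ?thesis
      unfolding cesaro_weight_def real_sqrt_divide real_sqrt_mult
      using x by (simp add: field_simps)
  qed
  finally show ?thesis by (simp add: ennreal_mult')
qed

text \<open>
  The mirror image of the row computation under \<open>t \<mapsto> 1 - t\<close>: the antiderivative in \<open>x\<close> is
  \<open>- 2 / (1 - t) * sqrt ((1 - x) / x)\<close>, which vanishes at \<open>1\<close>.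
\<close>

lemma cesaro_kernel_column:
  assumes t: "0 < t" "t < 1"
  shows "(\<integral>\<^sup>+x. cesaro_kernel x t * cesaro_weight x \<partial>unit_interval_measure) = 2 * ennreal (cesaro_weight t)"
proof -
  have "(\<integral>\<^sup>+x. cesaro_kernel x t * cesaro_weight x \<partial>unit_interval_measure) =
      - 2 / (1 - t) * sqrt ((1 - 1)) - - 2 / (1 - t) * sqrt ((1 - t) / t)"
  proof (rule nn_integral_unit_interval_FTC[where F = "\<lambda>x. - 2 / (1 - t) * sqrt ((1 - x) / x)"
        and f = "\<lambda>x. 1 / (x * (1 - t)) * cesaro_weight x" and a = t and b = 1, unfolded div_by_1])
    show "continuous_on {t..1} (\<lambda>x. - 2 / (1 - t) * sqrt ((1 - x) / x))"
      using t by (intro continuous_intros) auto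
    show "((\<lambda>x. - 2 / (1 - t) * sqrt ((1 - x) / x)) has_real_derivative
        1 / (x * (1 - t)) * cesaro_weight x) (at x)" if "x \<in> {t<..<1}" for x
    proof -
      have x: "0 < x" "x < 1" using that t by auto
      have "((\<lambda>x. - 2 / (1 - t) * sqrt ((1 - x) / x)) has_real_derivative
          - 2 / (1 - t) * (inverse (sqrt ((1 - x) / x)) / 2 * ((- x - (1 - x)) / x\<^sup>2))) (at x)"
        using t x by (auto intro!: derivative_eq_intros simp: power2_eq_square divide_less_0_iff)
      moreover have "inverse (sqrt ((1 - x) / x)) = x * cesaro_weight x"
      proof -
        have "sqrt x * sqrt x = x" using x by simp
        then show ?thesis
          unfolding cesaro_weight_def real_sqrt_divide real_sqrt_mult
          using x by (simp add: field_simps)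
      qed
      then have "- 2 / (1 - t) * (inverse (sqrt ((1 - x) / x)) / 2 * ((- x - (1 - x)) / x\<^sup>2)) =
          1 / (x * (1 - t)) * cesaro_weight x"
        using t x by (simp only:) (simp add: divide_simps power2_eq_square)
      ultimately show ?thesis by (rule DERIV_cong)
    qed
  qed (use t in \<open>auto simp: cesaro_kernel_def cesaro_weight_def\<close>)
  also have "- 2 / (1 - t) * sqrt ((1 - 1)) - - 2 / (1 - t) * sqrt ((1 - t) / t) = 2 * cesaro_weight t"
  proof -
    have "sqrt (1 - t) * sqrt (1 - t) = 1 - t" using t by simp
    then show ?thesis
      unfolding cesaro_weight_def real_sqrt_divide real_sqrt_mult
      using t by (simp add: field_simps)
  qed
  finally show ?thesis by (simp add: ennreal_mult')
qed

section \<open>The Cesaro operator on functions\<close>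

lemma sigma_finite_unit_interval: "sigma_finite_measure unit_interval_measure"
proof -
  interpret finite_measure unit_interval_measure
    by (rule finite_measure_lebesgue_on) simp
  show ?thesis by unfold_locales
qed

lemma id_measurable_unit_interval [measurable]:
  "(\<lambda>x. x) \<in> borel_measurable unit_interval_measure"
  by (intro measurable_restrict_space1 measurable_completion) simp

text \<open>
  The function \<open>1 / (1 - t)\<close> is not square integrable on \<open>(0,1)\<close>, but its truncation to \<open>t < x\<close> is
  bounded by \<open>1 / (1 - x)\<close>. The integrand is thus a product of two square-integrable functions.
\<close>

lemma set_integrable_cesaro_integrand:
  assumes f: "square_integrable f" and x: "0 < x" "x < 1"
  shows "set_integrable lebesgue {0<..<x} (\<lambda>t. f t / complex_of_real (1 - t))"
proof -
  define h where "h t = (if t < x then 1 / (1 - t) else 0)" for t :: real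
  have h_bound: "0 \<le> h t \<and> h t \<le> 1 / (1 - x)" for t
    using x by (auto simp: h_def field_simps)
  have h_meas: "h \<in> borel_measurable unit_interval_measure"
    unfolding h_def by measurable
  interpret finite_measure unit_interval_measure
    by (rule finite_measure_lebesgue_on) simp
  have "square_integrable (\<lambda>t. complex_of_real (h t))"
    unfolding square_integrable_def
  proof
    show meas: "(\<lambda>t. complex_of_real (h t)) \<in> borel_measurable unit_interval_measure"
      using h_meas by measurable
    have "(cmod (complex_of_real (h t)))\<^sup>2 \<le> (1 / (1 - x))\<^sup>2" for t
      using h_bound[of t] by (simp only: norm_of_real abs_of_nonneg power_mono)
    then show "integrable unit_interval_measure (\<lambda>t. (cmod (complex_of_real (h t)))\<^sup>2)"
      using h_meas by (intro integrable_const_bound[where B = "(1 / (1 - x))\<^sup>2"]) auto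
  qed
  then have "integrable unit_interval_measure (\<lambda>t. f t * cnj (complex_of_real (h t)))"
    by (rule integrable_mult_cnj[OF f])
  then have "integrable lebesgue (\<lambda>t. indicator {0<..<1} t *\<^sub>R (f t * cnj (complex_of_real (h t))))"
    by (subst (asm) integrable_restrict_space) auto
  also have "(\<lambda>t. indicator {0<..<1} t *\<^sub>R (f t * cnj (complex_of_real (h t)))) =
      (\<lambda>t. indicator {0<..<x} t *\<^sub>R (f t / complex_of_real (1 - t)))"
    using x by (auto simp: fun_eq_iff indicator_def h_def)
  finally show ?thesis by (simp add: set_integrable_def)
qed

lemma cesaro_eq_kernel_integral:
  assumes x: "0 < x" "x < 1"
  shows "cesaro f x = integral\<^sup>L unit_interval_measure (\<lambda>t. complex_of_real (cesaro_kernel x t) * f t)"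
proof -
  have "integral\<^sup>L unit_interval_measure (\<lambda>t. complex_of_real (cesaro_kernel x t) * f t) =
      integral\<^sup>L lebesgue (\<lambda>t. indicator {0<..<1} t *\<^sub>R (complex_of_real (cesaro_kernel x t) * f t))"
    by (subst integral_restrict_space) auto
  also have "\<dots> = integral\<^sup>L lebesgue (\<lambda>t. complex_of_real (1 / x) *
      (indicator {0<..<x} t *\<^sub>R (f t / complex_of_real (1 - t))))"
    using x by (intro Bochner_Integration.integral_cong) (auto simp: indicator_def cesaro_kernel_def)
  also have "\<dots> = cesaro f x"
    by (simp only: integral_mult_right_zero cesaro_def set_lebesgue_integral_def)
  finally show ?thesis ..
qed

text \<open>
  A Bochner integral that does not converge is \<open>0\<close>, so the estimate holds for every function.
\<close>

lemma norm_cesaro_le: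
  assumes x: "0 < x" "x < 1"
  shows "ennreal (cmod (cesaro f x)) \<le> (\<integral>\<^sup>+t. cesaro_kernel x t * cmod (f t) \<partial>unit_interval_measure)"
proof -
  have k: "0 \<le> cesaro_kernel x t" if "t \<in> {0<..<1}" for t
    using that x by (simp add: cesaro_kernel_def)
  let ?h = "\<lambda>t. complex_of_real (cesaro_kernel x t) * f t"
  have "ennreal (cmod (integral\<^sup>L unit_interval_measure ?h)) \<le>
      (\<integral>\<^sup>+t. cmod (?h t) \<partial>unit_interval_measure)"
  proof (cases "integrable unit_interval_measure ?h")
    case True
    then show ?thesis by (rule integral_norm_bound_ennreal)
  next
    case False
    then show ?thesis by (simp add: not_integrable_integral_eq)
  qed
  also have "\<dots> = (\<integral>\<^sup>+t. cesaro_kernel x t * cmod (f t) \<partial>unit_interval_measure)"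
    using k by (intro nn_integral_cong) (auto simp: norm_mult)
  finally show ?thesis by (simp add: cesaro_eq_kernel_integral[OF x])
qed

lemma cesaro_kernel_measurable:
  "(\<lambda>(x, t). cesaro_kernel x t) \<in> borel_measurable (unit_interval_measure \<Otimes>\<^sub>M unit_interval_measure)"
  unfolding cesaro_kernel_def by measurable

lemma cesaro_weight_measurable: "cesaro_weight \<in> borel_measurable unit_interval_measure"
  unfolding cesaro_weight_def by measurable

text \<open>
  With the variable limit of integration moved into the kernel, this is the measurability of a
  parameter integral over a fixed measure space.
\<close>

lemma cesaro_measurable:
  assumes f [measurable]: "f \<in> borel_measurable unit_interval_measure"
  shows "cesaro f \<in> borel_measurable unit_interval_measure"
proof -
  interpret sigma_finite_measure unit_interval_measure by (rule sigma_finite_unit_interval)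
  note [measurable] = cesaro_kernel_measurable
  have "(\<lambda>x. integral\<^sup>L unit_interval_measure (\<lambda>t. complex_of_real (cesaro_kernel x t) * f t))
      \<in> borel_measurable unit_interval_measure"
    by measurable
  then show ?thesis
    by (rule measurable_cong[THEN iffD1, rotated]) (simp add: cesaro_eq_kernel_integral)
qed

lemma nn_integral_norm_cesaro_le:
  assumes f [measurable]: "f \<in> borel_measurable unit_interval_measure"
  shows "(\<integral>\<^sup>+x. (cmod (cesaro f x))\<^sup>2 \<partial>unit_interval_measure) \<le>
    4 * (\<integral>\<^sup>+t. (cmod (f t))\<^sup>2 \<partial>unit_interval_measure)"
proof -
  have "(\<integral>\<^sup>+x. (cmod (cesaro f x))\<^sup>2 \<partial>unit_interval_measure) \<le>
      (\<integral>\<^sup>+x. (\<integral>\<^sup>+t. cesaro_kernel x t * cmod (f t) \<partial>unit_interval_measure)\<^sup>2 \<partial>unit_interval_measure)"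
    by (intro nn_integral_mono) (auto simp flip: ennreal_power intro!: power_mono norm_cesaro_le)
  also have "\<dots> \<le> 2 * 2 * (\<integral>\<^sup>+t. (cmod (f t))\<^sup>2 \<partial>unit_interval_measure)"
  proof (rule schur_test[OF sigma_finite_unit_interval sigma_finite_unit_interval
        cesaro_kernel_measurable cesaro_weight_measurable cesaro_weight_measurable])
    show "(\<lambda>t. cmod (f t)) \<in> borel_measurable unit_interval_measure" by measurable
  qed (auto simp: cesaro_kernel_row cesaro_kernel_column, auto simp: cesaro_kernel_def cesaro_weight_def)
  finally show ?thesis by simp
qed

lemma square_integrable_cesaro:
  assumes f: "square_integrable f"
  shows "square_integrable (cesaro f)"
    and "integral\<^sup>L unit_interval_measure (\<lambda>x. (cmod (cesaro f x))\<^sup>2) \<le>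
      4 * integral\<^sup>L unit_interval_measure (\<lambda>x. (cmod (f x))\<^sup>2)"
proof -
  have meas: "f \<in> borel_measurable unit_interval_measure"
    and int: "integrable unit_interval_measure (\<lambda>x. (cmod (f x))\<^sup>2)"
    using f by (auto simp: square_integrable_def)
  have [measurable]: "cesaro f \<in> borel_measurable unit_interval_measure"
    by (rule cesaro_measurable[OF meas])
  let ?I = "integral\<^sup>L unit_interval_measure (\<lambda>x. (cmod (f x))\<^sup>2)"
  have "(\<integral>\<^sup>+x. (cmod (cesaro f x))\<^sup>2 \<partial>unit_interval_measure) \<le>
      4 * (\<integral>\<^sup>+x. (cmod (f x))\<^sup>2 \<partial>unit_interval_measure)"
    by (rule nn_integral_norm_cesaro_le[OF meas])
  also have "\<dots> = ennreal (4 * ?I)"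
    using int by (subst nn_integral_eq_integral) (auto simp: ennreal_mult)
  finally have bound: "(\<integral>\<^sup>+x. (cmod (cesaro f x))\<^sup>2 \<partial>unit_interval_measure) \<le> ennreal (4 * ?I)" .
  have cint: "integrable unit_interval_measure (\<lambda>x. (cmod (cesaro f x))\<^sup>2)"
    by (rule integrableI_bounded) (use bound in \<open>auto intro: le_less_trans\<close>)
  then show "square_integrable (cesaro f)"
    by (simp add: square_integrable_def)
  show "integral\<^sup>L unit_interval_measure (\<lambda>x. (cmod (cesaro f x))\<^sup>2) \<le> 4 * ?I"
    using bound by (subst (asm) nn_integral_eq_integral[OF cint]) auto
qed

section \<open>The induced operator on square-integrable classes\<close>

lemma cesaro_cong_AE:
  assumes "square_integrable f" "square_integrable g"
    and "AE x in unit_interval_measure. f x = g x" and x: "0 < x" "x < 1"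
  shows "cesaro f x = cesaro g x"
  unfolding cesaro_eq_kernel_integral[OF x]
proof (rule integral_cong_AE)
  have [measurable]: "f \<in> borel_measurable unit_interval_measure"
    "g \<in> borel_measurable unit_interval_measure"
    using assms by (auto simp: square_integrable_def)
  have [measurable]: "cesaro_kernel x \<in> borel_measurable unit_interval_measure"
    unfolding cesaro_kernel_def by measurable
  show "(\<lambda>t. complex_of_real (cesaro_kernel x t) * f t) \<in> borel_measurable unit_interval_measure"
    "(\<lambda>t. complex_of_real (cesaro_kernel x t) * g t) \<in> borel_measurable unit_interval_measure"
    by measurable
qed (use assms(3) in eventually_elim, simp)

lemma cesaro_add:
  assumes f: "square_integrable f" and g: "square_integrable g" and x: "0 < x" "x < 1"
  shows "cesaro (\<lambda>t. f t + g t) x = cesaro f x + cesaro g x"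
  using set_integrable_cesaro_integrand[OF f x] set_integrable_cesaro_integrand[OF g x]
  by (simp add: cesaro_def add_divide_distrib distrib_left)

lemma cesaro_scale: "cesaro (\<lambda>t. c * f t) x = c * cesaro f x"
  by (simp add: cesaro_def flip: times_divide_eq_right)

lift_definition cesaro_L2 :: "L2 \<Rightarrow> L2" is cesaro
  by (auto intro!: square_integrable_cesaro AE_I2 cesaro_cong_AE)

lemma cesaro_L2_class: "square_integrable f \<Longrightarrow> cesaro_L2 (L2_class f) = L2_class (cesaro f)"
  by (simp add: cesaro_L2.abs_eq)

lemma cesaro_L2_add: "cesaro_L2 (u + v) = cesaro_L2 u + cesaro_L2 v"
  by transfer (auto intro!: square_integrable_cesaro square_integrable_add AE_I2 simp: cesaro_add)

lemma cesaro_L2_scaleC: "cesaro_L2 (scaleC_L2 c u) = scaleC_L2 c (cesaro_L2 u)"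
  by transfer
    (auto intro!: square_integrable_cesaro square_integrable_scale simp: cesaro_scale)

lemma norm_cesaro_L2_le: "norm (cesaro_L2 u) \<le> norm u * 2"
proof -
  obtain f where f: "square_integrable f" "u = L2_class f" by (rule L2_class_cases)
  have "norm (cesaro_L2 u) = sqrt (integral\<^sup>L unit_interval_measure (\<lambda>x. (cmod (cesaro f x))\<^sup>2))"
    using f by (simp add: cesaro_L2_class norm_L2_class square_integrable_cesaro)
  also have "\<dots> \<le> sqrt (4 * integral\<^sup>L unit_interval_measure (\<lambda>x. (cmod (f x))\<^sup>2))"
    using f by (simp add: square_integrable_cesaro)
  also have "\<dots> = norm u * 2"
    using f by (simp add: norm_L2_class real_sqrt_mult)
  finally show ?thesis .
qed

lemma bounded_linear_cesaro_L2: "bounded_linear cesaro_L2"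
proof (rule bounded_linear_intro)
  show "cesaro_L2 (r *\<^sub>R u) = r *\<^sub>R cesaro_L2 u" for r u
    by (simp add: scaleR_L2_def cesaro_L2_scaleC)
qed (rule cesaro_L2_add norm_cesaro_L2_le)+

theorem theorem2p2:
  shows "(\<forall>f. square_integrable f \<longrightarrow>
            (\<forall>x. 0 < x \<and> x < 1 \<longrightarrow>
               set_integrable lebesgue {0<..<x} (\<lambda>t. f t / complex_of_real (1 - t))) \<and>
            square_integrable (cesaro f)) \<and>
         (\<exists>C :: L2 \<Rightarrow> L2.
            (\<forall>f. square_integrable f \<longrightarrow> C (L2_class f) = L2_class (cesaro f)) \<and>
            bounded_linear C \<and>
            (\<forall>c u. C (scaleC_L2 c u) = scaleC_L2 c (C u)))"
  using set_integrable_cesaro_integrand square_integrable_cesaro(1) cesaro_L2_class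
    bounded_linear_cesaro_L2 cesaro_L2_scaleC
  by blast

end
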